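(* Let $\kappa\geq\aleph_0$ be a cardinal and let $(G,d)$ be a group of density $\kappa$ equipped with a bi-invariant metric $d$. Then there exist a group $H$ containing $G$ as a subgroup and a bi-invariant metric $\bar d$ on $H$ such that $\bar d$ extends $d$ and $H$ has a dense subgroup that is a free group with $\kappa$-many free generators.
   Context: A metric $d$ on a group $G$ is bi-invariant if $d(xay,xby)=d(a,b)$ for all $x,y,a,b\in G$. The density of a metric space is the least cardinality of a dense subset. *)

theory Defs
  imports "HOL-Algebra.Generated_Groups" "HOL-Analysis.Abstract_Metric_Spaces"
begin

unbundle cardinal_syntax

definition bi_invariant :: "('a, 'm) monoid_scheme \<Rightarrow> ('a \<Rightarrow> 'a \<Rightarrow> real) \<Rightarrow> bool" where
  "bi_invariant G d \<longleftrightarrow>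
    (\<forall>x\<in>carrier G. \<forall>y\<in>carrier G. \<forall>a\<in>carrier G. \<forall>b\<in>carrier G.
       d (x \<otimes>\<^bsub>G\<^esub> a \<otimes>\<^bsub>G\<^esub> y) (x \<otimes>\<^bsub>G\<^esub> b \<otimes>\<^bsub>G\<^esub> y) = d a b)"

definition metric_dense :: "'a set \<Rightarrow> ('a \<Rightarrow> 'a \<Rightarrow> real) \<Rightarrow> 'a set \<Rightarrow> bool" where
  "metric_dense M d S \<longleftrightarrow> S \<subseteq> M \<and> Metric_space.mtopology M d closure_of S = M"

text \<open>Cardinals are cardinal orders over an arbitrary type, compared across types
  up to \<open>=o\<close>.  Density is therefore a relation: \<open>\<kappa>\<close> is, up to \<open>=o\<close>,
  the least cardinality of a dense subset.\<close>

definition has_density :: "'a set \<Rightarrow> ('a \<Rightarrow> 'a \<Rightarrow> real) \<Rightarrow> 'k rel \<Rightarrow> bool" where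
  "has_density M d \<kappa> \<longleftrightarrow>
    (\<exists>S. metric_dense M d S \<and> |S| =o \<kappa>) \<and>
    (\<forall>S. metric_dense M d S \<longrightarrow> \<kappa> \<le>o |S| )"

text \<open>Words in letters \<open>x\<close> and \<open>x\<inverse>\<close>: the pair \<open>(x, True)\<close> stands for the
  letter \<open>x\<close> and \<open>(x, False)\<close> for its formal inverse.\<close>

fun letter_value :: "('a, 'm) monoid_scheme \<Rightarrow> 'a \<times> bool \<Rightarrow> 'a" where
  "letter_value G (x, b) = (if b then x else inv\<^bsub>G\<^esub> x)"

primrec word_value :: "('a, 'm) monoid_scheme \<Rightarrow> ('a \<times> bool) list \<Rightarrow> 'a" where
  "word_value G [] = \<one>\<^bsub>G\<^esub>"
| "word_value G (l # w) = letter_value G l \<otimes>\<^bsub>G\<^esub> word_value G w"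

definition reduced_word :: "('a \<times> bool) list \<Rightarrow> bool" where
  "reduced_word w \<longleftrightarrow> successively (\<lambda>l l'. \<not> (fst l = fst l' \<and> snd l \<noteq> snd l')) w"

definition free_generators :: "('a, 'm) monoid_scheme \<Rightarrow> 'a set \<Rightarrow> bool" where
  "free_generators G X \<longleftrightarrow>
    X \<subseteq> carrier G \<and> generate G X = carrier G \<and>
    (\<forall>w. set w \<subseteq> X \<times> UNIV \<and> w \<noteq> [] \<and> reduced_word w \<longrightarrow> word_value G w \<noteq> \<one>\<^bsub>G\<^esub>)"

end

theory Submission
  imports Defs
begin

text \<open>Let \<open>S\<close> be a dense subset of \<open>G\<close> of size \<open>\<kappa>\<close>. The free group on \<open>S \<times> \<nat>\<close> carries a bi-invariant
  metric in which the generator \<open>(s, m)\<close> is at distance \<open>1 / (m + 1)\<close> from the identity: two elements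
  are close if their images agree after killing all generators \<open>(s, m)\<close> with \<open>m > n\<close>, for a large
  \<open>n\<close>. In the product of \<open>G\<close> with this free group, under the sum metric, the elements
  \<open>(s, (s, m))\<close> are free generators because their second components are, and they converge to
  \<open>(s, 1)\<close> as \<open>m\<close> grows. The closure of the subgroup they generate therefore contains
  \<open>G \<times> {1}\<close>, hence everything generated by the two together. This group has the
  cardinality of \<open>G\<close>, so it can be copied onto a subset of the original type.\<close>

section \<open>Letters acting as permutations of words\<close>

text \<open>On words that are not reduced, \<open>prepend\<close> is the identity; this makes it a bijection of the
  whole type.\<close>

definition prepend :: "'x \<times> bool \<Rightarrow> ('x \<times> bool) list \<Rightarrow> ('x \<times> bool) list" where
  "prepend l w =
    (if reduced_word w
     then if w \<noteq> [] \<and> fst (hd w) = fst l \<and> snd (hd w) \<noteq> snd l then tl w else l # w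
     else w)"

text \<open>If a letter cancels against the head of a reduced word, the remaining word cannot start
  with that same letter, so prepending the inverse puts the head back; if it does not cancel, the
  inverse removes it again. This is why the first two letters are split off.\<close>

lemma prepend_inverse: "prepend (x, \<not> b) (prepend (x, b) w) = w"
  by (cases w; cases "tl w") (auto simp: prepend_def reduced_word_def prod_eq_iff)

lemma bij_prepend: "bij (prepend l)"
proof (rule o_bij)
  show "prepend (fst l, \<not> snd l) \<circ> prepend l = id"
    using prepend_inverse[of "fst l" "snd l"] by (simp add: fun_eq_iff)
  show "prepend l \<circ> prepend (fst l, \<not> snd l) = id"
    using prepend_inverse[of "fst l" "\<not> snd l"] by (simp add: fun_eq_iff)
qed

text \<open>No cancellation ever occurs while a reduced word is rebuilt from the empty one. The
  action on \<open>[]\<close> thus recovers the word, which is the source of freeness.\<close>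

lemma foldr_prepend_reduced: "reduced_word w \<Longrightarrow> foldr prepend w [] = w"
  by (induction w) (auto simp: prepend_def reduced_word_def successively_Cons)

section \<open>The group of sequences of permutations\<close>

text \<open>The free group is realised by permutations of words. Working with sequences of permutations,
  the \<open>n\<close>-th entry can record the image after killing all generators of index above \<open>n\<close>.\<close>

definition bij_seqs :: "(nat \<Rightarrow> 'w \<Rightarrow> 'w) monoid" where
  "bij_seqs = \<lparr>carrier = {f. \<forall>n. bij (f n)}, monoid.mult = \<lambda>f g n. f n \<circ> g n, one = \<lambda>n. id\<rparr>"

lemma mult_bij_seqs_apply: "(f \<otimes>\<^bsub>bij_seqs\<^esub> g) n = f n \<circ> g n"
  by (simp add: bij_seqs_def)

lemma group_bij_seqs: "group bij_seqs"
proof (rule groupI)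
  fix f :: "nat \<Rightarrow> 'w \<Rightarrow> 'w"
  assume "f \<in> carrier bij_seqs"
  then show "\<exists>g\<in>carrier bij_seqs. g \<otimes>\<^bsub>bij_seqs\<^esub> f = \<one>\<^bsub>bij_seqs\<^esub>"
    by (intro bexI[of _ "\<lambda>n. inv_into UNIV (f n)"])
      (auto simp: bij_seqs_def bij_imp_bij_inv bij_is_inj)
qed (auto simp: bij_seqs_def bij_comp o_assoc)

lemma inv_bij_seqs:
  assumes "f \<in> carrier bij_seqs"
  shows "inv\<^bsub>bij_seqs\<^esub> f = (\<lambda>n. inv_into UNIV (f n))"
proof (rule group.inv_equality[OF group_bij_seqs])
  show "(\<lambda>n. inv_into UNIV (f n)) \<otimes>\<^bsub>bij_seqs\<^esub> f = \<one>\<^bsub>bij_seqs\<^esub>"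
    using assms by (auto simp: bij_seqs_def bij_is_inj)
qed (use assms in \<open>auto simp: bij_seqs_def bij_imp_bij_inv\<close>)

section \<open>The first-difference ultrametric\<close>

text \<open>A standard metric on a countable product of discrete spaces. Indices start at zero,
  hence the \<open>Suc\<close>.\<close>

definition first_diff_dist :: "(nat \<Rightarrow> 'b) \<Rightarrow> (nat \<Rightarrow> 'b) \<Rightarrow> real" where
  "first_diff_dist f g = (if f = g then 0 else inverse (real (Suc (LEAST n. f n \<noteq> g n))))"

text \<open>With \<open>k\<close> the first differing index, both sides amount to
  \<open>n < k\<close>, because \<open>inverse (real (Suc n))\<close> strictly decreases in
  \<open>n\<close>.\<close>

lemma first_diff_dist_less_iff:
  "first_diff_dist f g < inverse (real (Suc n)) \<longleftrightarrow> (\<forall>m\<le>n. f m = g m)"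
proof (cases "f = g")
  case False
  define k where "k = (LEAST n. f n \<noteq> g n)"
  have "\<exists>n. f n \<noteq> g n"
    using False by auto
  then have k: "f k \<noteq> g k"
    unfolding k_def by (rule LeastI_ex)
  have less_k: "f m = g m" if "m < k" for m
    using not_less_Least[OF that[unfolded k_def]] by simp
  have "first_diff_dist f g < inverse (real (Suc n)) \<longleftrightarrow> n < k"
    using False by (simp add: first_diff_dist_def k_def[symmetric])
  also have "\<dots> \<longleftrightarrow> (\<forall>m\<le>n. f m = g m)"
  proof
    assume "n < k"
    then show "\<forall>m\<le>n. f m = g m"
      using less_k by simp
  next
    assume "\<forall>m\<le>n. f m = g m"
    then show "n < k"
      using k not_le by blast
  qed
  finally show ?thesis .
qed (simp add: first_diff_dist_def)

lemma first_diff_dist_nonneg: "0 \<le> first_diff_dist f g"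
  by (simp add: first_diff_dist_def)

lemma first_diff_dist_commute: "first_diff_dist f g = first_diff_dist g f"
proof -
  have "(\<lambda>n. f n \<noteq> g n) = (\<lambda>n. g n \<noteq> f n)"
    by auto
  then show ?thesis
    by (auto simp: first_diff_dist_def)
qed

lemma first_diff_dist_eq_0_iff: "first_diff_dist f g = 0 \<longleftrightarrow> f = g"
  by (simp add: first_diff_dist_def)

text \<open>At the first index where \<open>f\<close> and \<open>h\<close> differ, \<open>g\<close>
  must differ from one of them, so one of the two other distances is at least as large.\<close>

lemma first_diff_dist_ultra:
  "first_diff_dist f h \<le> max (first_diff_dist f g) (first_diff_dist g h)"
proof (cases "f = h")
  case False
  define n where "n = (LEAST n. f n \<noteq> h n)"
  have "\<exists>n. f n \<noteq> h n"
    using False by auto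
  then have "f n \<noteq> h n"
    unfolding n_def by (rule LeastI_ex)
  then have "\<not> (first_diff_dist f g < inverse (real (Suc n)) \<and>
      first_diff_dist g h < inverse (real (Suc n)))"
    unfolding first_diff_dist_less_iff by auto
  moreover have "first_diff_dist f h = inverse (real (Suc n))"
    using False by (simp add: first_diff_dist_def n_def)
  ultimately show ?thesis
    by (metis le_max_iff_disj not_less)
next
  case True
  then have "first_diff_dist f h = 0"
    by (simp add: first_diff_dist_eq_0_iff)
  then show ?thesis
    using first_diff_dist_nonneg[of f g] by (simp add: le_max_iff_disj)
qed

lemma first_diff_dist_triangle:
  "first_diff_dist f h \<le> first_diff_dist f g + first_diff_dist g h"
  using first_diff_dist_ultra[of f h g] first_diff_dist_nonneg[of f g]
    first_diff_dist_nonneg[of g h] by linarith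

text \<open>The metric sees only the set of indices of agreement; bi-invariance is reduced to
  this.\<close>

lemma first_diff_dist_cong:
  assumes "\<And>n. f n = g n \<longleftrightarrow> f' n = g' n"
  shows "first_diff_dist f g = first_diff_dist f' g'"
  using assms by (auto simp: first_diff_dist_def fun_eq_iff)

text \<open>Bijections cancel on either side of a composition, so at every index multiplication
  preserves and reflects equality.\<close>

lemma bi_invariant_first_diff_dist: "bi_invariant bij_seqs first_diff_dist"
  unfolding bi_invariant_def
proof (intro ballI first_diff_dist_cong)
  fix x y a b :: "nat \<Rightarrow> 'w \<Rightarrow> 'w" and n
  assume "x \<in> carrier bij_seqs" "y \<in> carrier bij_seqs"
  then have "inj (x n)" "surj (y n)"
    by (auto simp: bij_seqs_def bij_is_inj bij_is_surj)
  have "x n \<circ> (a n \<circ> y n) = x n \<circ> (b n \<circ> y n) \<longleftrightarrow> a n = b n"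
    using \<open>inj (x n)\<close> \<open>surj (y n)\<close> by (metis fun.inj_map inj_eq surj_fun_eq fun_eq_iff comp_apply surjD)
  then show "(x \<otimes>\<^bsub>bij_seqs\<^esub> a \<otimes>\<^bsub>bij_seqs\<^esub> y) n = (x \<otimes>\<^bsub>bij_seqs\<^esub> b \<otimes>\<^bsub>bij_seqs\<^esub> y) n \<longleftrightarrow> a n = b n"
    by (simp add: bij_seqs_def o_assoc)
qed

lemma Metric_space_first_diff_dist: "Metric_space M first_diff_dist"
  by unfold_locales
    (simp_all add: first_diff_dist_nonneg first_diff_dist_commute first_diff_dist_eq_0_iff
      first_diff_dist_triangle)

section \<open>Free generators converging to the identity\<close>

definition small_generator :: "'x \<times> nat \<Rightarrow> nat \<Rightarrow> (('x \<times> nat) \<times> bool) list \<Rightarrow> (('x \<times> nat) \<times> bool) list" where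
  "small_generator x n = (if snd x \<le> n then prepend (x, True) else id)"

lemma small_generator_carrier: "small_generator x \<in> carrier bij_seqs"
  by (simp add: bij_seqs_def small_generator_def bij_prepend)

text \<open>The second component \<open>Suc m\<close> makes entries \<open>0\<close> to
  \<open>m\<close> trivial, which gives the strict bound.\<close>

lemma first_diff_dist_small_generator:
  "first_diff_dist \<one>\<^bsub>bij_seqs\<^esub> (small_generator (s, Suc m)) < inverse (real (Suc m))"
  unfolding first_diff_dist_less_iff by (simp add: bij_seqs_def small_generator_def)

text \<open>At an index where neither generator is killed, applying the permutation to
  \<open>[]\<close> reads off the generator.\<close>

lemma inj_small_generator: "inj small_generator"
proof (rule injI)
  fix x y :: "'x \<times> nat"
  assume "small_generator x = small_generator y"
  then have "small_generator x (max (snd x) (snd y)) [] = small_generator y (max (snd x) (snd y)) []"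
    by simp
  then show "x = y"
    by (simp add: small_generator_def prepend_def reduced_word_def)
qed

lemma inv_prepend: "inv_into UNIV (prepend (x, b)) = prepend (x, \<not> b)"
  by (rule Hilbert_Choice.inv_equality) (use prepend_inverse[of x b] prepend_inverse[of x "\<not> b"] in simp_all)

text \<open>From index \<open>n\<close> on no letter of \<open>w\<close> is killed, so this entry is
  the plain action of the word.\<close>

lemma word_value_small_generator:
  assumes "\<forall>l\<in>set w. snd (fst l) \<le> n"
  shows "word_value bij_seqs (map (map_prod small_generator id) w) n = foldr prepend w"
  using assms
proof (induction w)
  case Nil
  then show ?case by (simp add: bij_seqs_def id_def)
next
  case (Cons l w)
  obtain x b where l: "l = (x, b)"
    by fastforce
  have "letter_value bij_seqs (small_generator x, b) n = prepend l"
    using Cons.prems small_generator_carrier[of x]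
    by (auto simp: l inv_bij_seqs inv_prepend small_generator_def)
  then show ?case
    using Cons by (simp add: l mult_bij_seqs_apply del: letter_value.simps)
qed

text \<open>A word mentions finitely many generators, so a single late entry detects it: there the
  product sends \<open>[]\<close> to \<open>w\<close> itself.\<close>

lemma small_generator_free:
  assumes "reduced_word w" "w \<noteq> []"
  shows "word_value bij_seqs (map (map_prod small_generator id) w) \<noteq> \<one>\<^bsub>bij_seqs\<^esub>"
proof
  assume *: "word_value bij_seqs (map (map_prod small_generator id) w) = \<one>\<^bsub>bij_seqs\<^esub>"
  define n where "n = Max ((\<lambda>l. snd (fst l)) ` set w)"
  have "\<forall>l\<in>set w. snd (fst l) \<le> n"
    by (simp add: n_def)
  from word_value_small_generator[OF this] have "foldr prepend w [] = []"
    unfolding * by (simp add: bij_seqs_def fun_eq_iff)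
  then show False
    using assms by (simp add: foldr_prepend_reduced)
qed

section \<open>Detecting freeness through a homomorphism\<close>

lemma hom_word_value:
  assumes "Group.group F" "Group.group K" "\<phi> \<in> hom F K" "fst ` set w \<subseteq> carrier F"
  shows "word_value F w \<in> carrier F"
    and "\<phi> (word_value F w) = word_value K (map (map_prod \<phi> id) w)"
proof -
  interpret group_hom F K \<phi>
    using assms by (simp add: group_hom_def group_hom_axioms_def)
  have "word_value F w \<in> carrier F \<and> \<phi> (word_value F w) = word_value K (map (map_prod \<phi> id) w)"
    using assms(4)
  proof (induction w)
    case (Cons l w)
    then show ?case
      by (cases l) auto
  qed auto
  then show "word_value F w \<in> carrier F"
    and "\<phi> (word_value F w) = word_value K (map (map_prod \<phi> id) w)"
    by auto
qed

text \<open>Renaming letters keeps an adjacent inverse pair an inverse pair.\<close>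

lemma reduced_word_mapD: "reduced_word (map (map_prod e id) w) \<Longrightarrow> reduced_word w"
  unfolding reduced_word_def successively_map by (erule successively_mono) auto

text \<open>A relation among the generators in \<open>F\<close> would be carried by
  \<open>\<phi>\<close> to a relation in \<open>K\<close>, where it is excluded.\<close>

lemma free_generators_imageI:
  assumes "Group.group F" "Group.group K" "\<phi> \<in> hom F K"
    and carr: "e ` I \<subseteq> carrier F" and gen: "generate F (e ` I) = carrier F"
    and free: "\<And>w. \<lbrakk>set w \<subseteq> I \<times> UNIV; w \<noteq> []; reduced_word w\<rbrakk> \<Longrightarrow>
      word_value K (map (map_prod (\<phi> \<circ> e) id) w) \<noteq> \<one>\<^bsub>K\<^esub>"
  shows "free_generators F (e ` I)"
  unfolding free_generators_def
proof (intro conjI allI impI carr gen)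
  fix w :: "('a \<times> bool) list"
  assume w: "set w \<subseteq> e ` I \<times> UNIV \<and> w \<noteq> [] \<and> reduced_word w"
  then have "w \<in> lists (map_prod e id ` (I \<times> UNIV))"
    by (fastforce simp: map_prod_def image_iff)
  \<comment> \<open>Letters are lifted to indices by any choice of preimages; the lift stays reduced
    by \<open>reduced_word_mapD\<close>.\<close>
  then obtain v where v: "set v \<subseteq> I \<times> UNIV" "w = map (map_prod e id) v"
    by (auto simp: lists_image)
  show "word_value F w \<noteq> \<one>\<^bsub>F\<^esub>"
  proof
    assume "word_value F w = \<one>\<^bsub>F\<^esub>"
    moreover have "\<phi> (word_value F w) = word_value K (map (map_prod \<phi> id) w)"
      by (rule hom_word_value[OF assms(1-3)]) (use w carr in force)
    moreover have "map (map_prod \<phi> id) w = map (map_prod (\<phi> \<circ> e) id) v"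
      by (auto simp: v)
    ultimately have "word_value K (map (map_prod (\<phi> \<circ> e) id) v) = \<one>\<^bsub>K\<^esub>"
      using hom_one[OF assms(3,1,2)] by simp
    moreover have "reduced_word v" "v \<noteq> []"
      using w reduced_word_mapD by (auto simp: v)
    ultimately show False
      using free v by blast
  qed
qed

section \<open>Cardinality of a generated subgroup\<close>

text \<open>Countably many stages exhaust the generated set, and squares and countable unions do not
  exceed an infinite cardinal bound.\<close>

lemma card_of_generate_ordLeq:
  assumes inf: "infinite C" and A: "|A| \<le>o |C|"
  shows "|generate G A| \<le>o |C|"
proof -
  \<comment> \<open>Inverses enter only at stage zero, since the rules of \<open>generate\<close>
    invert generators alone.\<close>
  define B where "B n = ((\<lambda>U. U \<union> case_prod (monoid.mult G) ` (U \<times> U)) ^^ n)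
    (insert \<one>\<^bsub>G\<^esub> (A \<union> m_inv G ` A))" for n
  have B0: "B 0 = insert \<one>\<^bsub>G\<^esub> (A \<union> m_inv G ` A)"
    and BS: "B (Suc n) = B n \<union> case_prod (monoid.mult G) ` (B n \<times> B n)" for n
    by (simp_all add: B_def)
  have C: "infinite (Field |C| )" "Card_order |C|"
    using inf by (simp_all add: Field_card_of card_of_card_order_on)
  have leq: "|B n| \<le>o |C|" for n
  proof (induction n)
    case 0
    have "|{\<one>\<^bsub>G\<^esub>}| \<le>o |C|"
      using inf by (intro card_of_singl_ordLeq) auto
    moreover have "|m_inv G ` A| \<le>o |C|"
      using card_of_image A by (rule ordLeq_transitive)
    ultimately have "|{\<one>\<^bsub>G\<^esub>} \<union> (A \<union> m_inv G ` A)| \<le>o |C|"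
      using A C by (intro card_of_Un_ordLeq_infinite_Field)
    then show ?case
      by (simp add: B0)
  next
    case (Suc n)
    have "|B n \<times> B n| \<le>o |C|"
      using C Suc.IH Suc.IH by (intro card_of_Times_ordLeq_infinite_Field)
    then have "|case_prod (monoid.mult G) ` (B n \<times> B n)| \<le>o |C|"
      by (rule ordLeq_transitive[OF card_of_image])
    then show ?case
      unfolding BS using C Suc.IH by (intro card_of_Un_ordLeq_infinite_Field)
  qed
  have mono: "B m \<subseteq> B n" if "m \<le> n" for m n
    by (rule lift_Suc_mono_le[OF _ that]) (auto simp: BS)
  have "x \<in> (\<Union>n. B n)" if "x \<in> generate G A" for x
    using that
  proof induction
    case (eng a b)
    then obtain m n where "a \<in> B m" "b \<in> B n"
      by auto
    then have "a \<in> B (max m n)" "b \<in> B (max m n)"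
      using mono[of m "max m n"] mono[of n "max m n"] by auto
    then have "a \<otimes>\<^bsub>G\<^esub> b \<in> B (Suc (max m n))"
      by (auto simp: BS)
    then show ?case
      by blast
  qed (use B0 in blast)+
  then have "generate G A \<subseteq> (\<Union>n. B n)"
    by blast
  moreover have "|\<Union>n. B n| \<le>o |C|"
    using inf leq by (intro card_of_UNION_ordLeq_infinite) (auto simp: infinite_iff_card_of_nat)
  ultimately show ?thesis
    using card_of_mono1 ordLeq_transitive by blast
qed

section \<open>Density of a generated subgroup\<close>

text \<open>Under a bi-invariant metric the closure of a subgroup is again a subgroup, so it is
  enough to approximate generators.\<close>

lemma metric_dense_generate:
  assumes "Group.group H" "Metric_space (carrier H) d" "bi_invariant H d"
    and X: "X \<subseteq> carrier H" and A: "A \<subseteq> carrier H" "generate H A = carrier H"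
    and approx: "\<And>a r. \<lbrakk>a \<in> A; 0 < r\<rbrakk> \<Longrightarrow> \<exists>y\<in>generate H X. d a y < r"
  shows "metric_dense (carrier H) d (generate H X)"
proof -
  interpret Group.group H by fact
  interpret Metric_space "carrier H" d by fact
  have inv: "d (x \<otimes>\<^bsub>H\<^esub> a \<otimes>\<^bsub>H\<^esub> y) (x \<otimes>\<^bsub>H\<^esub> b \<otimes>\<^bsub>H\<^esub> y) = d a b"
    if "x \<in> carrier H" "y \<in> carrier H" "a \<in> carrier H" "b \<in> carrier H" for x y a b
    using assms(3) that by (simp add: bi_invariant_def)
  have X': "generate H X \<subseteq> carrier H"
    using X by (rule generate_incl)
  \<comment> \<open>Multiplying by the inverse of \<open>a\<close> on the left and that of
    \<open>b\<close> on the right swaps the pair of inverses, so inversion is an isometry.\<close>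
  have inv_dist: "d (inv\<^bsub>H\<^esub> a) (inv\<^bsub>H\<^esub> b) = d a b" if "a \<in> carrier H" "b \<in> carrier H" for a b
    using inv[of "inv\<^bsub>H\<^esub> a" "inv\<^bsub>H\<^esub> b" a b] that commute by (simp add: m_assoc)
  have approx_inv: "\<exists>y\<in>generate H X. d (inv\<^bsub>H\<^esub> a) y < r" if a: "a \<in> A" "0 < r" for a r
  proof -
    obtain y where "y \<in> generate H X" "d a y < r"
      using approx[OF a] by blast
    then show ?thesis
      using X X' A a by (intro bexI[of _ "inv\<^bsub>H\<^esub> y"]) (auto simp: inv_dist subset_iff generate_m_inv_closed)
  qed
  have "\<forall>r>0. \<exists>y\<in>generate H X. d z y < r" if "z \<in> generate H A" for z
    using that
  proof induction
    case one
    then show ?case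
      by (metis generate.one one_closed zero)
  next
    case (eng a b)
    show ?case
    proof (intro allI impI)
      fix r :: real
      assume "0 < r"
      with eng.IH obtain u v where uv: "u \<in> generate H X" "v \<in> generate H X"
        "d a u < r / 2" "d b v < r / 2"
        by (meson half_gt_zero)
      have carr: "a \<in> carrier H" "b \<in> carrier H" "u \<in> carrier H" "v \<in> carrier H"
        using eng.hyps A uv X' by auto
      \<comment> \<open>One factor is replaced at a time, passing through the product of
        \<open>u\<close> and \<open>b\<close>.\<close>
      have "d (a \<otimes>\<^bsub>H\<^esub> b) (u \<otimes>\<^bsub>H\<^esub> v) \<le> d (a \<otimes>\<^bsub>H\<^esub> b) (u \<otimes>\<^bsub>H\<^esub> b) + d (u \<otimes>\<^bsub>H\<^esub> b) (u \<otimes>\<^bsub>H\<^esub> v)"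
        using carr by (intro triangle) auto
      also have "\<dots> = d a u + d b v"
        using inv[of "\<one>\<^bsub>H\<^esub>" b a u] inv[of u "\<one>\<^bsub>H\<^esub>" b v] carr by simp
      finally show "\<exists>y\<in>generate H X. d (a \<otimes>\<^bsub>H\<^esub> b) y < r"
        using uv by (intro bexI[of _ "u \<otimes>\<^bsub>H\<^esub> v"]) (auto intro: generate.eng)
    qed
  qed (use approx approx_inv in auto)
  then show ?thesis
    unfolding metric_dense_def metric_closure_of using A X' by (force simp: in_mball)
qed

section \<open>Transfer of metrics and group structure\<close>

lemma Metric_space_pullback:
  assumes "Metric_space M D" "\<theta> ` N \<subseteq> M" "inj_on \<theta> N"
  shows "Metric_space N (\<lambda>x y. D (\<theta> x) (\<theta> y))"
proof -
  interpret Metric_space M D by fact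
  show ?thesis
  proof
    fix x y z assume "x \<in> N" "y \<in> N" "z \<in> N"
    then have "\<theta> x \<in> M" "\<theta> y \<in> M" "\<theta> z \<in> M"
      using assms(2) by auto
    then show "D (\<theta> x) (\<theta> z) \<le> D (\<theta> x) (\<theta> y) + D (\<theta> y) (\<theta> z)"
      by (rule triangle)
  next
    fix x y assume "x \<in> N" "y \<in> N"
    then show "D (\<theta> x) (\<theta> y) = 0 \<longleftrightarrow> x = y"
      using assms(2,3) by (metis image_subset_iff inj_on_eq_iff zero)
  qed (auto simp: commute)
qed

lemma bi_invariant_pullback:
  assumes "bi_invariant P D" "\<theta> \<in> hom H P" "Group.group H"
  shows "bi_invariant H (\<lambda>x y. D (\<theta> x) (\<theta> y))"
proof -
  interpret Group.group H by fact
  show ?thesis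
    using assms(1,2) by (auto simp: bi_invariant_def hom_def Pi_iff)
qed

lemma Metric_space_sum:
  assumes "Metric_space M d" "Metric_space N e"
  shows "Metric_space (M \<times> N) (\<lambda>p q. d (fst p) (fst q) + e (snd p) (snd q))"
proof -
  interpret M: Metric_space M d by fact
  interpret N: Metric_space N e by fact
  show ?thesis
  proof
    fix p q r assume "p \<in> M \<times> N" "q \<in> M \<times> N" "r \<in> M \<times> N"
    then show "d (fst p) (fst r) + e (snd p) (snd r)
      \<le> d (fst p) (fst q) + e (snd p) (snd q) + (d (fst q) (fst r) + e (snd q) (snd r))"
      using M.triangle[of "fst p" "fst q" "fst r"] N.triangle[of "snd p" "snd q" "snd r"] by auto
  qed (auto simp: M.commute N.commute add_nonneg_eq_0_iff prod_eq_iff)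
qed

lemma bi_invariant_DirProd:
  assumes "bi_invariant G d" "bi_invariant K e"
  shows "bi_invariant (G \<times>\<times> K) (\<lambda>p q. d (fst p) (fst q) + e (snd p) (snd q))"
  using assms by (auto simp: bi_invariant_def)

text \<open>This lets a group built inside a product be copied onto a subset of the type of
  \<open>G\<close>.\<close>

definition transport_group :: "('a, 'm) monoid_scheme \<Rightarrow> ('a \<Rightarrow> 'b) \<Rightarrow> 'b monoid" where
  "transport_group M \<psi> = \<lparr>carrier = \<psi> ` carrier M,
    monoid.mult = \<lambda>x y. \<psi> (inv_into (carrier M) \<psi> x \<otimes>\<^bsub>M\<^esub> inv_into (carrier M) \<psi> y),
    one = \<psi> \<one>\<^bsub>M\<^esub>\<rparr>"

lemma transport_group:
  assumes "Group.group M" "inj_on \<psi> (carrier M)"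
  shows "Group.group (transport_group M \<psi>)" "\<psi> \<in> iso M (transport_group M \<psi>)"
proof -
  interpret Group.group M by fact
  show "Group.group (transport_group M \<psi>)"
  proof (rule groupI)
    fix x assume "x \<in> carrier (transport_group M \<psi>)"
    then obtain a where "a \<in> carrier M" "x = \<psi> a"
      by (auto simp: transport_group_def)
    then show "\<exists>y\<in>carrier (transport_group M \<psi>). y \<otimes>\<^bsub>transport_group M \<psi>\<^esub> x = \<one>\<^bsub>transport_group M \<psi>\<^esub>"
      using assms(2) by (intro bexI[of _ "\<psi> (inv\<^bsub>M\<^esub> a)"]) (auto simp: transport_group_def)
  qed (use assms(2) in \<open>auto simp: transport_group_def m_assoc\<close>)
  show "\<psi> \<in> iso M (transport_group M \<psi>)"
    using assms(2) by (auto simp: iso_def hom_def transport_group_def bij_betw_def)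
qed

section \<open>Construction of the extension and its dense free subgroup\<close>

theorem theorem0p3:
  fixes G :: "('a, 'm) monoid_scheme"
    and d :: "'a \<Rightarrow> 'a \<Rightarrow> real"
    and \<kappa> :: "'k rel"
  assumes "Card_order \<kappa>" and "natLeq \<le>o \<kappa>"
    and "group G" and "Metric_space (carrier G) d" and "bi_invariant G d"
    and "has_density (carrier G) d \<kappa>"
  shows "\<exists>(H :: 'a monoid) (\<iota> :: 'a \<Rightarrow> 'a) (dbar :: 'a \<Rightarrow> 'a \<Rightarrow> real).
           group H \<and> \<iota> \<in> mon G H \<and>
           Metric_space (carrier H) dbar \<and> bi_invariant H dbar \<and>
           (\<forall>x\<in>carrier G. \<forall>y\<in>carrier G. dbar (\<iota> x) (\<iota> y) = d x y) \<and>
           (\<exists>F X. subgroup F H \<and> metric_dense (carrier H) dbar F \<and>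
                  free_generators (H\<lparr>carrier := F\<rparr>) X \<and> |X| =o \<kappa>)"
proof -
  interpret G: Group.group G by fact
  interpret d: Metric_space "carrier G" d by fact
  let ?D = "first_diff_dist :: (nat \<Rightarrow> (('a \<times> nat) \<times> bool) list \<Rightarrow> (('a \<times> nat) \<times> bool) list) \<Rightarrow> _"
  let ?Q = "bij_seqs :: (nat \<Rightarrow> (('a \<times> nat) \<times> bool) list \<Rightarrow> (('a \<times> nat) \<times> bool) list) monoid"
  interpret Q: Group.group ?Q by (rule group_bij_seqs)
  obtain S where S: "metric_dense (carrier G) d S" "|S| =o \<kappa>"
    using assms(6) by (auto simp: has_density_def)
  have SG: "S \<subseteq> carrier G"
    using S by (simp add: metric_dense_def)
  have "|UNIV :: nat set| \<le>o |S|"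
    using assms(2) S(2) by (meson card_of_nat ordIso_ordLeq_trans ordIso_symmetric ordLeq_ordIso_trans)
  then have inf: "infinite S" "infinite (carrier G)"
    using SG by (auto simp: infinite_iff_card_of_nat[symmetric] dest: finite_subset)
  have S_UNIV: "|S \<times> (UNIV :: nat set)| =o |S|"
    using inf(1) \<open>|UNIV :: nat set| \<le>o |S|\<close> by (intro card_of_Times_infinite_simps) auto

  define P where "P = G \<times>\<times> ?Q"
  define dP where "dP p q = d (fst p) (fst q) + ?D (snd p) (snd q)" for p q
  interpret P: Group.group P
    unfolding P_def by (rule DirProd_group) unfold_locales
  have metric_P: "Metric_space (carrier P) dP"
    unfolding P_def dP_def carrier_DirProd
    by (rule Metric_space_sum[OF assms(4) Metric_space_first_diff_dist])
  have bi_inv_P: "bi_invariant P dP"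
    unfolding P_def dP_def
    by (rule bi_invariant_DirProd[OF assms(5) bi_invariant_first_diff_dist])

  define j where "j g = (g, \<one>\<^bsub>?Q\<^esub>)" for g :: 'a
  define e where "e p = (fst p, small_generator p)" for p :: "'a \<times> nat"
  define A where "A = j ` carrier G \<union> e ` (S \<times> UNIV)"
  have A: "A \<subseteq> carrier P"
    using SG small_generator_carrier by (auto simp: A_def P_def j_def e_def)
  \<comment> \<open>The whole product may be larger than \<open>G\<close>. The subgroup generated by
    \<open>A\<close> holds both the copy of \<open>G\<close> and the future free generators, and its
    size stays bounded by that of \<open>G\<close>.\<close>
  define M where "M = P\<lparr>carrier := generate P A\<rparr>"
  have sub_M: "subgroup (generate P A) P"
    by (rule P.generate_is_subgroup[OF A])
  interpret M: Group.group M
    unfolding M_def by (rule P.subgroup_imp_group[OF sub_M])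
  have A_M: "A \<subseteq> carrier M"
    by (auto simp: M_def intro: generate.incl)
  have M_P: "carrier M \<subseteq> carrier P"
    using P.generate_incl[OF A] by (simp add: M_def)
  have gen_M: "generate M A = carrier M"
    using P.generate_consistent[OF _ sub_M, of A] A_M by (simp add: M_def)

  have "|j ` carrier G| \<le>o |carrier G|"
    by (rule card_of_image)
  moreover have "|e ` (S \<times> UNIV)| \<le>o |carrier G|"
    using card_of_image[of e] S_UNIV card_of_mono1[OF SG]
    by (meson ordLeq_ordIso_trans ordLeq_transitive)
  ultimately have "|A| \<le>o |carrier G|"
    unfolding A_def using inf(2)
    by (intro card_of_Un_ordLeq_infinite_Field) (simp_all add: Field_card_of card_of_card_order_on)
  then have "|carrier M| \<le>o |carrier G|"
    using inf(2) by (simp add: M_def card_of_generate_ordLeq)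
  \<comment> \<open>The image of this injection is unrelated to the position of
    \<open>carrier G\<close> in its type; \<open>G\<close> embeds in \<open>H\<close> through
    \<open>\<psi> \<circ> j\<close>.\<close>
  then obtain \<psi> :: "_ \<Rightarrow> 'a" where \<psi>: "inj_on \<psi> (carrier M)"
    unfolding card_of_ordLeq[symmetric] by blast

  define H where "H = transport_group M \<psi>"
  define \<theta> where "\<theta> = inv_into (carrier M) \<psi>"
  define dbar where "dbar x y = dP (\<theta> x) (\<theta> y)" for x y
  interpret H: Group.group H
    unfolding H_def by (rule transport_group[OF M.is_group \<psi>])
  have \<psi>_iso: "\<psi> \<in> iso M H"
    unfolding H_def by (rule transport_group[OF M.is_group \<psi>])
  have \<psi>_hom: "group_hom M H \<psi>"
    using M.is_group H.is_group iso_imp_homomorphism[OF \<psi>_iso]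
    by (intro group_hom.intro group_hom_axioms.intro)
  have carrier_H: "carrier H = \<psi> ` carrier M"
    by (simp add: H_def transport_group_def)
  have \<theta>_\<psi>: "\<theta> (\<psi> x) = x" if "x \<in> carrier M" for x
    using that \<psi> by (simp add: \<theta>_def)
  have \<theta>_iso: "\<theta> \<in> iso H M"
    unfolding \<theta>_def by (rule M.iso_set_sym[OF \<psi>_iso])
  then have \<theta>_hom: "\<theta> \<in> hom H P"
    using M_P by (auto simp: iso_def hom_def M_def)
  have inj_\<theta>: "inj_on \<theta> (carrier H)"
    using \<theta>_iso by (simp add: iso_def bij_betw_def)
  have dbar_\<psi>: "dbar (\<psi> x) (\<psi> y) = dP x y" if "x \<in> carrier M" "y \<in> carrier M" for x y
    using that by (simp add: dbar_def \<theta>_\<psi>)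
  have metric_H: "Metric_space (carrier H) dbar"
    unfolding dbar_def by (rule Metric_space_pullback[OF metric_P hom_carrier[OF \<theta>_hom] inj_\<theta>])
  have bi_inv_H: "bi_invariant H dbar"
    unfolding dbar_def using bi_inv_P \<theta>_hom H.is_group by (rule bi_invariant_pullback)

  have j_M: "j g \<in> carrier M" if "g \<in> carrier G" for g
    using that A_M by (auto simp: A_def)
  have e_M: "e p \<in> carrier M" if "p \<in> S \<times> UNIV" for p
    using that A_M by (auto simp: A_def)
  have \<iota>: "\<psi> \<circ> j \<in> mon G H"
  proof -
    have "j (x \<otimes>\<^bsub>G\<^esub> y) = j x \<otimes>\<^bsub>M\<^esub> j y" for x y
      by (simp add: j_def M_def P_def)
    then have "j \<in> hom G M"
      using j_M by (simp add: hom_def)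
    then have "\<psi> \<circ> j \<in> hom G H"
      by (rule hom_compose[OF _ iso_imp_homomorphism[OF \<psi>_iso]])
    moreover have "inj_on j (carrier G)" "j ` carrier G \<subseteq> carrier M"
      using j_M by (auto simp: inj_on_def j_def)
    then have "inj_on (\<psi> \<circ> j) (carrier G)"
      by (intro comp_inj_on) (auto intro: inj_on_subset[OF \<psi>])
    ultimately show ?thesis
      by (simp add: mon_def)
  qed
  \<comment> \<open>Both second components are the identity, so only the summand \<open>d\<close>
    survives.\<close>
  have isometry: "dbar ((\<psi> \<circ> j) x) ((\<psi> \<circ> j) y) = d x y" if "x \<in> carrier G" "y \<in> carrier G" for x y
    using that j_M by (simp add: dbar_\<psi>) (simp add: dP_def j_def first_diff_dist_eq_0_iff)
  define X where "X = (\<psi> \<circ> e) ` (S \<times> UNIV)"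
  define F where "F = generate H X"
  have X: "X \<subseteq> carrier H"
    using e_M by (auto simp: X_def carrier_H)
  have sub_F: "subgroup F H"
    unfolding F_def by (rule H.generate_is_subgroup[OF X])
  have dense_F: "metric_dense (carrier H) dbar F"
    unfolding F_def
  proof (rule metric_dense_generate[OF H.is_group metric_H bi_inv_H X])
    show "\<psi> ` A \<subseteq> carrier H" "generate H (\<psi> ` A) = carrier H"
      using A_M group_hom.generate_img[OF \<psi>_hom A_M] by (auto simp: gen_M carrier_H)
    fix a and r :: real
    assume "a \<in> \<psi> ` A" "0 < r"
    then consider g where "g \<in> carrier G" "a = \<psi> (j g)" | "a \<in> X"
      by (auto simp: A_def X_def)
    then show "\<exists>y\<in>generate H X. dbar a y < r"
    proof cases
      case 1
      have "g \<in> d.mtopology closure_of S"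
        using S(1) 1 by (simp add: metric_dense_def)
      then obtain s where "s \<in> S" "s \<in> d.mball g (r / 2)"
        using half_gt_zero[OF \<open>0 < r\<close>] unfolding d.metric_closure_of by blast
      then have s: "s \<in> S" "d g s < r / 2"
        by simp_all
      obtain n where n: "inverse (real (Suc n)) < r / 2"
        using reals_Archimedean[of "r / 2"] \<open>0 < r\<close> by auto
      \<comment> \<open>The sum metric splits the error: one half pays for approximating
        \<open>g\<close> by \<open>s\<close>, the other for the distance of the small generator from
        the identity.\<close>
      have "dbar a (\<psi> (e (s, Suc n))) = d g s + ?D \<one>\<^bsub>?Q\<^esub> (small_generator (s, Suc n))"
        using 1 j_M e_M s by (simp add: dbar_\<psi>) (simp add: dP_def j_def e_def)
      also have "\<dots> < r"
        using s n first_diff_dist_small_generator[of s n] by linarith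
      finally show ?thesis
        using s by (intro bexI[of _ "\<psi> (e (s, Suc n))"]) (auto simp: X_def intro: generate.incl)
    next
      case 2
      then show ?thesis
        using X \<open>0 < r\<close> Metric_space.zero[OF metric_H, of a a]
        by (intro bexI[of _ a]) (auto intro: generate.incl)
    qed
  qed
  have free_X: "free_generators (H\<lparr>carrier := F\<rparr>) X"
    unfolding X_def
  proof (rule free_generators_imageI)
    show "Group.group (H\<lparr>carrier := F\<rparr>)"
      by (rule H.subgroup_imp_group[OF sub_F])
    show "Group.group ?Q"
      by (rule Q.is_group)
    \<comment> \<open>Projection to the second component sends the generator indexed by
      \<open>p\<close> to \<open>small_generator p\<close>, whose freeness is known.\<close>
    show "snd \<circ> \<theta> \<in> hom (H\<lparr>carrier := F\<rparr>) ?Q"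
      using \<theta>_hom subgroup.subset[OF sub_F]
      by (auto simp: hom_def P_def Pi_iff mult_DirProd' subset_iff mem_Times_iff)
    show "(\<psi> \<circ> e) ` (S \<times> UNIV) \<subseteq> carrier (H\<lparr>carrier := F\<rparr>)"
      by (auto simp: F_def X_def intro: generate.incl)
    show "generate (H\<lparr>carrier := F\<rparr>) ((\<psi> \<circ> e) ` (S \<times> UNIV)) = carrier (H\<lparr>carrier := F\<rparr>)"
      using H.generate_consistent[OF _ sub_F, of X] by (auto simp: F_def X_def intro: generate.incl)
    fix w :: "(('a \<times> nat) \<times> bool) list"
    assume w: "set w \<subseteq> (S \<times> UNIV) \<times> UNIV" "w \<noteq> []" "reduced_word w"
    have "map (map_prod (snd \<circ> \<theta> \<circ> (\<psi> \<circ> e)) id) w = map (map_prod small_generator id) w"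
    proof (intro map_cong[OF refl])
      fix l assume "l \<in> set w"
      then have "fst l \<in> S \<times> UNIV"
        using w(1) by (metis mem_Times_iff subsetD)
      then have "\<theta> (\<psi> (e (fst l))) = e (fst l)"
        by (rule \<theta>_\<psi>[OF e_M])
      then show "map_prod (snd \<circ> \<theta> \<circ> (\<psi> \<circ> e)) id l = map_prod small_generator id l"
        by (cases l) (simp add: e_def)
    qed
    then show "word_value ?Q (map (map_prod (snd \<circ> \<theta> \<circ> (\<psi> \<circ> e)) id) w) \<noteq> \<one>\<^bsub>?Q\<^esub>"
      by (simp only: small_generator_free[OF w(3,2)] not_False_eq_True)
  qed
  have card_X: "|X| =o \<kappa>"
  proof -
    \<comment> \<open>Distinct indices are already separated by the second component, so there are
      as many generators as indices.\<close>
    have "inj_on e (S \<times> UNIV)"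
      by (simp add: inj_on_def e_def inj_eq[OF inj_small_generator])
    moreover have "inj_on \<psi> (e ` (S \<times> UNIV))"
      using \<psi> by (rule inj_on_subset) (use e_M in blast)
    ultimately have "inj_on (\<psi> \<circ> e) (S \<times> UNIV)"
      by (rule comp_inj_on)
    then have "|S \<times> (UNIV :: nat set)| =o |X|"
      unfolding X_def by (rule card_of_ordIsoI[OF inj_on_imp_bij_betw])
    then show ?thesis
      using S_UNIV S(2) by (meson ordIso_symmetric ordIso_transitive)
  qed
  show ?thesis
    by (rule exI[of _ H], rule exI[of _ "\<psi> \<circ> j"], rule exI[of _ dbar])
      (intro conjI ballI exI[of _ F] exI[of _ X] H.is_group \<iota> metric_H bi_inv_H isometry
        sub_F dense_F free_X card_X)
qed

end
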